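(* Let $F:\mathbb{H}_2\to\mathbb{C}$ be a (differentiable) Siegel modular function with trivial multiplier system, i.e. $F(\Gamma\cdot M)=F(M)$ for all $\Gamma\in\mathrm{Sp}(4,\mathbb{Z})$ and $M\in\mathbb{H}_2$. Then $F$ has an extremum (critical point) at each of the six elliptic fixed points $\sigma_i$, $i=1,\dots,6$, of $\mathrm{Sp}(4,\mathbb{Z})$; that is, $\partial_M F(\sigma_i)=0$ for $i=1,\dots,6$.
   Context: $\mathbb{H}_2=\{M\in \mathrm{Mat}(2\times2,\mathbb{C}) : M^T=M,\ \mathrm{Im}\,M>0\}$ is the Siegel upper half-space of genus 2. $\mathrm{Sp}(4,\mathbb{Z})$ is the group of integer $4\times4$ matrices $\Gamma=\begin{pmatrix}A&B\\C&D\end{pmatrix}$ ($2\times2$ blocks) with $\Gamma J\Gamma^T=J$, $J=\begin{pmatrix}0&I_2\\-I_2&0\end{pmatrix}$; it acts on $\mathbb{H}_2$ by $\Gamma\cdot M=(AM+B)(CM+D)^{-1}$. $\partial_MF$ denotes the symmetric $2\times2$ matrix of first (Wirtinger) derivatives $\partial_{M_{ij}}F$ with respect to the entries of $M$, with the convention $\partial_{M_{km}}M_{ij}=\frac12(\delta_{ik}\delta_{jm}+\delta_{kj}\delta_{mi})$. Thus, writing $M=\begin{pmatrix}T&Z\\Z&U\end{pmatrix}$, $\partial_MF=\begin{pmatrix}\partial_TF&\frac12\partial_ZF\\ \frac12\partial_ZF&\partial_UF\end{pmatrix}$. "Differentiable" is meant in the real sense; $F$ is not required to be holomorphic. Put $\zeta=e^{2\pi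 i/5}$, $\eta=\tfrac13(1+2\sqrt2\,i)$, $\rho=e^{2\pi i/3}$. The elliptic fixed points are $$\sigma_1=\begin{pmatrix}\zeta&\zeta+\zeta^{-2}\\ \zeta+\zeta^{-2}&-\zeta^{-1}\end{pmatrix},\quad \sigma_2=\begin{pmatrix}\eta&\frac12(\eta-1)\\ \frac12(\eta-1)&\eta\end{pmatrix},\quad \sigma_3=\begin{pmatrix}i&0\\0&i\end{pmatrix},$$ $$\sigma_4=\begin{pmatrix}\rho&0\\0&\rho\end{pmatrix},\quad \sigma_5=\frac{i}{\sqrt3}\begin{pmatrix}2&1\\1&2\end{pmatrix},\quad \sigma_6=\begin{pmatrix}\rho&0\\0&i\end{pmatrix}.$$ *)

theory Defs
  imports "HOL-Analysis.Analysis"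
begin

definition mat2 :: "'a \<Rightarrow> 'a \<Rightarrow> 'a \<Rightarrow> 'a \<Rightarrow> ('a::zero) ^ 2 ^ 2" where
  "mat2 a b c d = vector [vector [a, b], vector [c, d]]"

definition siegel_H2 :: "(complex ^ 2 ^ 2) set" where
  "siegel_H2 = {M. transpose M = M \<and>
     (\<forall>x :: real ^ 2. x \<noteq> 0 \<longrightarrow> 0 < x \<bullet> ((\<chi> i j. Im (M $ i $ j)) *v x))}"

definition symp_J :: "int ^ 4 ^ 4" where
  "symp_J = vector [vector [ 0,  0, 1, 0],
                    vector [ 0,  0, 0, 1],
                    vector [-1,  0, 0, 0],
                    vector [ 0, -1, 0, 0]]"

lemma symp_J_entry:
  "symp_J $ i $ j = (if (i, j) \<in> {(1, 3), (2, 4)} then 1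
                     else if (i, j) \<in> {(3, 1), (4, 2)} then -1 else 0)"
proof -
  have "\<forall>i j. symp_J $ i $ j = (if (i, j) \<in> {(1, 3), (2, 4)} then 1
                     else if (i, j) \<in> {(3, 1), (4, 2)} then -1 else 0)"
    unfolding forall_4 by (simp add: symp_J_def vector_def)
  then show ?thesis by blast
qed

definition Sp4Z :: "(int ^ 4 ^ 4) set" where
  "Sp4Z = {G. G ** symp_J ** transpose G = symp_J}"

text \<open>The block of \<open>G\<close> with rows \<open>r1, r2\<close> and columns \<open>c1, c2\<close>,
  read as a complex matrix.\<close>

definition block :: "int ^ 4 ^ 4 \<Rightarrow> 4 \<Rightarrow> 4 \<Rightarrow> 4 \<Rightarrow> 4 \<Rightarrow> complex ^ 2 ^ 2" where
  "block G r1 r2 c1 c2 =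
     mat2 (of_int (G $ r1 $ c1)) (of_int (G $ r1 $ c2))
          (of_int (G $ r2 $ c1)) (of_int (G $ r2 $ c2))"

definition siegel_act :: "int ^ 4 ^ 4 \<Rightarrow> complex ^ 2 ^ 2 \<Rightarrow> complex ^ 2 ^ 2" where
  "siegel_act G M =
     (let A = block G 1 2 1 2; B = block G 1 2 3 4;
          C = block G 3 4 1 2; D = block G 3 4 3 4
      in (A ** M + B) ** matrix_inv (C ** M + D))"

text \<open>\<open>\<partial>/\<partial>z = (\<partial>/\<partial>x - \<i> \<partial>/\<partial>y) / 2\<close> for a function of one complex variable \<open>z = x + \<i> y\<close>
  that need only be differentiable in the real sense.\<close>

definition wirtinger :: "(complex \<Rightarrow> complex) \<Rightarrow> complex \<Rightarrow> complex" where
  "wirtinger f z =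
     (vector_derivative (\<lambda>t::real. f (z + of_real t)) (at 0)
      - \<i> * vector_derivative (\<lambda>t::real. f (z + \<i> * of_real t)) (at 0)) / 2"

text \<open>With \<open>M = (T, Z; Z, U)\<close>, the matrix \<open>(\<partial>\<^sub>T F, \<partial>\<^sub>Z F / 2; \<partial>\<^sub>Z F / 2, \<partial>\<^sub>U F)\<close>. Only values of \<open>F\<close> at
  symmetric matrices enter, so for \<open>M\<close> in \<open>siegel_H2\<close>, which is open in the space of symmetric
  matrices, it depends only on \<open>F\<close> restricted to \<open>siegel_H2\<close>.\<close>

definition dM :: "(complex ^ 2 ^ 2 \<Rightarrow> complex) \<Rightarrow> complex ^ 2 ^ 2 \<Rightarrow> complex ^ 2 ^ 2" where
  "dM F M =
     (let T = M $ 1 $ 1; Z = M $ 1 $ 2; U = M $ 2 $ 2;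
          FT = wirtinger (\<lambda>t. F (mat2 t Z Z U)) T;
          FZ = wirtinger (\<lambda>z. F (mat2 T z z U)) Z;
          FU = wirtinger (\<lambda>u. F (mat2 T Z Z u)) U
      in mat2 FT (FZ / 2) (FZ / 2) FU)"

lemma wirtinger_const [simp]: "wirtinger (\<lambda>_. c) z = 0"
  by (simp add: wirtinger_def)

lemma wirtinger_ident [simp]: "wirtinger (\<lambda>w. w) z = 1"
proof -
  have "vector_derivative (\<lambda>t::real. z + of_real t) (at 0) = (1::complex)"
    by (rule vector_derivative_at) (auto intro!: derivative_eq_intros)
  moreover have "vector_derivative (\<lambda>t::real. z + \<i> * of_real t) (at 0) = \<i>"
    by (rule vector_derivative_at) (auto intro!: derivative_eq_intros)
  ultimately show ?thesis by (simp add: wirtinger_def)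
qed

text \<open>The convention for derivatives with respect to the entries of a symmetric matrix.\<close>

lemma dM_entry:
  "dM (\<lambda>M. M $ i $ j) M $ k $ m =
     (1/2) * ((if i = k \<and> j = m then 1 else 0) + (if k = j \<and> m = i then 1 else 0))"
proof -
  have "\<forall>i j k m :: 2. dM (\<lambda>M. M $ i $ j) M $ k $ m =
     (1/2) * ((if i = k \<and> j = m then 1 else 0) + (if k = j \<and> m = i then 1 else 0))"
    unfolding forall_2 by (simp add: dM_def mat2_def Let_def)
  then show ?thesis by blast
qed

definition zeta5 :: complex where "zeta5 = exp (2 * of_real pi * \<i> / 5)"

definition eta :: complex where "eta = (1 + 2 * of_real (sqrt 2) * \<i>) / 3"

definition rho :: complex where "rho = exp (2 * of_real pi * \<i> / 3)"

definition sigma1 :: "complex ^ 2 ^ 2" where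
  "sigma1 = mat2 zeta5 (zeta5 + zeta5 powi (-2))
                 (zeta5 + zeta5 powi (-2)) (- (zeta5 powi (-1)))"

definition sigma2 :: "complex ^ 2 ^ 2" where
  "sigma2 = mat2 eta ((1/2) * (eta - 1)) ((1/2) * (eta - 1)) eta"

definition sigma3 :: "complex ^ 2 ^ 2" where
  "sigma3 = mat2 \<i> 0 0 \<i>"

definition sigma4 :: "complex ^ 2 ^ 2" where
  "sigma4 = mat2 rho 0 0 rho"

definition sigma5 :: "complex ^ 2 ^ 2" where
  "sigma5 = (let c = \<i> / of_real (sqrt 3) in mat2 (c * 2) (c * 1) (c * 1) (c * 2))"

definition sigma6 :: "complex ^ 2 ^ 2" where
  "sigma6 = mat2 rho 0 0 \<i>"

end

theory Submission
  imports Defs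
begin

text \<open>
  If \<open>\<Gamma> = (A, B; C, D)\<close> fixes \<open>\<sigma>\<close> and \<open>Q = C \<sigma> + D\<close>, then \<open>\<Gamma>\<close> acts on the tangent space at \<open>\<sigma>\<close>
  (the symmetric matrices) by \<open>H \<mapsto> (Q\<^sup>T)\<^sup>-\<^sup>1 H Q\<^sup>-\<^sup>1\<close>. Invariance of \<open>F\<close> makes its real derivative \<open>L\<close> at \<open>\<sigma>\<close>
  invariant under this action and its inverse \<open>H \<mapsto> Q\<^sup>T H Q\<close>. The latter has the eigenvalues
  \<open>\<lambda>\<^sup>2, \<lambda> \<mu>, \<mu>\<^sup>2\<close>, where \<open>\<lambda>, \<mu>\<close> are those of \<open>Q\<close>. When none of them is 1, \<open>L\<close> vanishes. For each of the
  six points a single suitable \<open>\<Gamma>\<close> exists.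
\<close>

section \<open>Inverses and limits of 2x2 matrices\<close>

lemma matrix_eq_2x2:
  fixes A B :: "'a ^ 2 ^ 2"
  shows "A = B \<longleftrightarrow> A $ 1 $ 1 = B $ 1 $ 1 \<and> A $ 1 $ 2 = B $ 1 $ 2
    \<and> A $ 2 $ 1 = B $ 2 $ 1 \<and> A $ 2 $ 2 = B $ 2 $ 2"
  by (auto simp: vec_eq_iff forall_2)

lemma symmetric_2x2_iff:
  fixes A :: "'a ^ 2 ^ 2"
  shows "transpose A = A \<longleftrightarrow> A $ 2 $ 1 = A $ 1 $ 2"
  by (auto simp: matrix_eq_2x2 transpose_def)

lemma mat2_nth [simp]:
  "mat2 a b c d $ 1 $ 1 = a" "mat2 a b c d $ 1 $ 2 = b"
  "mat2 a b c d $ 2 $ 1 = c" "mat2 a b c d $ 2 $ 2 = d"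
  by (simp_all add: mat2_def)

lemma matrix_mult_2x2:
  fixes A B :: "'a::semiring_1 ^ 2 ^ 2"
  shows "(A ** B) $ i $ j = A $ i $ 1 * B $ 1 $ j + A $ i $ 2 * B $ 2 $ j"
  by (simp add: matrix_matrix_mult_def sum_2)

lemma matrix_inv_unique:
  fixes A B :: "'a::field ^ 'n ^ 'n"
  assumes "A ** B = mat 1"
  shows "matrix_inv A = B"
proof -
  have BA: "B ** A = mat 1"
    using assms matrix_left_right_inverse by blast
  \<comment> \<open>\<open>matrix_inv\<close> is a choice among two-sided inverses, and
    \<open>B\<close> witnesses that one exists.\<close>
  have "A ** matrix_inv A = mat 1 \<and> matrix_inv A ** A = mat 1"
    unfolding matrix_inv_def by (rule someI[of _ B]) (simp add: assms BA)
  then show ?thesis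
    by (metis BA matrix_mul_assoc matrix_mul_lid matrix_mul_rid)
qed

lemma matrix_inv_2x2:
  fixes A :: "'a::field ^ 2 ^ 2"
  assumes "det A \<noteq> 0"
  shows "matrix_inv A = mat2 (A $ 2 $ 2 / det A) (- A $ 1 $ 2 / det A)
    (- A $ 2 $ 1 / det A) (A $ 1 $ 1 / det A)"
proof (rule matrix_inv_unique)
  show "A ** mat2 (A $ 2 $ 2 / det A) (- A $ 1 $ 2 / det A)
    (- A $ 2 $ 1 / det A) (A $ 1 $ 1 / det A) = mat 1"
    using assms
    by (simp add: matrix_eq_2x2 matrix_mult_2x2 mat_def divide_simps)
       (simp add: det_2 algebra_simps)
qed

lemma matrix_inv_det_nz:
  fixes A :: "'a::field ^ 'n ^ 'n"
  assumes "det A \<noteq> 0"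
  shows "A ** matrix_inv A = mat 1" "matrix_inv A ** A = mat 1"
  using assms matrix_inv_unique unfolding invertible_det_nz[symmetric] invertible_def by metis+

lemma matrix_mult_left_cancel:
  fixes A :: "'a::field ^ 'n ^ 'n"
  assumes "det A \<noteq> 0"
  shows "A ** X = A ** Y \<longleftrightarrow> X = Y"
  by (metis assms matrix_inv_det_nz(2) matrix_mul_assoc matrix_mul_lid)

lemma matrix_mult_right_cancel:
  fixes A :: "'a::field ^ 'n ^ 'n"
  assumes "det A \<noteq> 0"
  shows "X ** A = Y ** A \<longleftrightarrow> X = Y"
  by (metis assms matrix_inv_det_nz(1) matrix_mul_assoc matrix_mul_rid)

text \<open>The adjugate formula makes the entries of the inverse quotients of polynomials. It
  describes \<open>matrix_inv (f x)\<close> only where the determinant is nonzero, which holds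
  eventually, so the limit is computed for the formula and then transferred.\<close>

lemma tendsto_matrix_inv_2x2:
  fixes f :: "'b \<Rightarrow> complex ^ 2 ^ 2"
  assumes f: "(f \<longlongrightarrow> A) F" and A: "det A \<noteq> 0"
  shows "((\<lambda>x. matrix_inv (f x)) \<longlongrightarrow> matrix_inv A) F"
proof -
  have entry: "((\<lambda>x. f x $ i $ j) \<longlongrightarrow> A $ i $ j) F" for i j
    by (intro tendsto_vec_nth f)
  have det: "((\<lambda>x. det (f x)) \<longlongrightarrow> det A) F"
    unfolding det_2 by (intro tendsto_intros entry)
  have ev: "\<forall>\<^sub>F x in F. det (f x) \<noteq> 0"
    using tendsto_imp_eventually_ne[OF det A] .
  have "((\<lambda>x. mat2 (f x $ 2 $ 2 / det (f x)) (- f x $ 1 $ 2 / det (f x))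
    (- f x $ 2 $ 1 / det (f x)) (f x $ 1 $ 1 / det (f x))) \<longlongrightarrow> matrix_inv A) F"
    unfolding matrix_inv_2x2[OF A]
  proof (intro vec_tendstoI)
    fix i j :: 2
    have "\<forall>i j :: 2. ((\<lambda>x. mat2 (f x $ 2 $ 2 / det (f x)) (- f x $ 1 $ 2 / det (f x))
      (- f x $ 2 $ 1 / det (f x)) (f x $ 1 $ 1 / det (f x)) $ i $ j) \<longlongrightarrow>
      mat2 (A $ 2 $ 2 / det A) (- A $ 1 $ 2 / det A)
      (- A $ 2 $ 1 / det A) (A $ 1 $ 1 / det A) $ i $ j) F"
      unfolding forall_2 mat2_nth by (intro conjI tendsto_intros entry det A)
    then show "((\<lambda>x. mat2 (f x $ 2 $ 2 / det (f x)) (- f x $ 1 $ 2 / det (f x))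
      (- f x $ 2 $ 1 / det (f x)) (f x $ 1 $ 1 / det (f x)) $ i $ j) \<longlongrightarrow>
      mat2 (A $ 2 $ 2 / det A) (- A $ 1 $ 2 / det A)
      (- A $ 2 $ 1 / det A) (A $ 1 $ 1 / det A) $ i $ j) F"
      by blast
  qed
  then show ?thesis
    by (rule Lim_transform_eventually) (use ev in eventually_elim, simp add: matrix_inv_2x2)
qed

lemma tendsto_matrix_mult:
  fixes f g :: "'b \<Rightarrow> complex ^ 2 ^ 2"
  assumes "(f \<longlongrightarrow> A) F" "(g \<longlongrightarrow> B) F"
  shows "((\<lambda>x. f x ** g x) \<longlongrightarrow> A ** B) F"
proof (intro vec_tendstoI)
  fix i j
  show "((\<lambda>x. (f x ** g x) $ i $ j) \<longlongrightarrow> (A ** B) $ i $ j) F"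
    unfolding matrix_mult_2x2 by (intro tendsto_intros assms)
qed

lemma transpose_add: "transpose (A + B) = transpose A + transpose B"
  by (simp add: transpose_def vec_eq_iff)

section \<open>The upper half-space as a relatively open set\<close>

text \<open>Sylvester's criterion for the imaginary part. It replaces the quantifier over vectors by
  two strict inequalities between continuous functions.\<close>

lemma siegel_H2_iff:
  "M \<in> siegel_H2 \<longleftrightarrow> transpose M = M \<and> 0 < Im (M $ 1 $ 1)
    \<and> (Im (M $ 1 $ 2))\<^sup>2 < Im (M $ 1 $ 1) * Im (M $ 2 $ 2)"
proof (cases "transpose M = M")
  case True
  define a b c where "a = Im (M $ 1 $ 1)" and "b = Im (M $ 1 $ 2)" and "c = Im (M $ 2 $ 2)"
  have "Im (M $ 2 $ 1) = b"
    using True by (simp add: b_def symmetric_2x2_iff)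
  then have q: "x \<bullet> ((\<chi> i j. Im (M $ i $ j)) *v x) = a * (x $ 1)\<^sup>2 + 2 * b * x $ 1 * x $ 2 + c * (x $ 2)\<^sup>2"
    for x :: "real ^ 2"
    by (simp add: inner_vec_def matrix_vector_mult_def sum_2 a_def b_def c_def
        power2_eq_square algebra_simps)
  have "(\<forall>x :: real ^ 2. x \<noteq> 0 \<longrightarrow> 0 < x \<bullet> ((\<chi> i j. Im (M $ i $ j)) *v x))
    \<longleftrightarrow> 0 < a \<and> b\<^sup>2 < a * c" (is "?L \<longleftrightarrow> ?R")
  proof
    assume L: ?L
    have "(vector [1, 0] :: real ^ 2) \<noteq> 0"
      by (simp add: vec_eq_iff forall_2)
    with L have a: "0 < a"
      by (auto simp: q dest!: spec[of _ "vector [1, 0] :: real ^ 2"])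
    \<comment> \<open>At this vector the quadratic form takes the value
      \<open>a * (a * c - b^2)\<close>, so its positivity is that of the determinant.\<close>
    have "(vector [- b, a] :: real ^ 2) \<noteq> 0"
      using a by (simp add: vec_eq_iff forall_2)
    then have "0 < a * b\<^sup>2 + 2 * b * (- b) * a + c * a\<^sup>2"
      using L q[of "vector [- b, a]"] by auto
    then have "0 < a * (a * c - b\<^sup>2)"
      by (simp add: power2_eq_square algebra_simps)
    with a show ?R by (simp add: zero_less_mult_iff)
  next
    assume R: ?R
    show ?L
    proof (intro allI impI)
      fix x :: "real ^ 2"
      assume x: "x \<noteq> 0"
      \<comment> \<open>Completing the square in \<open>a\<close> times the quadratic form.\<close>
      have "0 < (a * x $ 1 + b * x $ 2)\<^sup>2 + (a * c - b\<^sup>2) * (x $ 2)\<^sup>2"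
      proof (cases "x $ 2 = 0")
        case True
        then have "x $ 1 \<noteq> 0" using x by (simp add: vec_eq_iff forall_2)
        then show ?thesis using R True by simp
      next
        case False
        then show ?thesis using R by (intro add_nonneg_pos) auto
      qed
      also have "\<dots> = a * (x \<bullet> ((\<chi> i j. Im (M $ i $ j)) *v x))"
        by (simp add: q power2_eq_square algebra_simps)
      finally show "0 < x \<bullet> ((\<chi> i j. Im (M $ i $ j)) *v x)"
        using R by (simp add: zero_less_mult_iff)
    qed
  qed
  with True show ?thesis by (simp add: siegel_H2_def a_def b_def c_def)
qed (simp add: siegel_H2_def)

text \<open>Openness of the half-space inside the symmetric matrices, in the form needed for
  curves.\<close>

lemma eventually_in_siegel_H2:
  assumes f: "(f \<longlongrightarrow> M) F" and M: "M \<in> siegel_H2"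
    and sym: "\<forall>\<^sub>F x in F. transpose (f x) = f x"
  shows "\<forall>\<^sub>F x in F. f x \<in> siegel_H2"
proof -
  have entry: "((\<lambda>x. Im (f x $ i $ j)) \<longlongrightarrow> Im (M $ i $ j)) F" for i j
    by (intro tendsto_intros f)
  have "\<forall>\<^sub>F x in F. 0 < Im (f x $ 1 $ 1)"
    using M by (intro order_tendstoD(1)[OF entry]) (simp add: siegel_H2_iff)
  moreover have "\<forall>\<^sub>F x in F. 0 < Im (f x $ 1 $ 1) * Im (f x $ 2 $ 2) - (Im (f x $ 1 $ 2))\<^sup>2"
    by (rule order_tendstoD(1)[of _ "Im (M $ 1 $ 1) * Im (M $ 2 $ 2) - (Im (M $ 1 $ 2))\<^sup>2"])
       (use M in \<open>auto simp: siegel_H2_iff intro!: tendsto_intros entry\<close>)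
  ultimately show ?thesis
    using sym by eventually_elim (simp add: siegel_H2_iff)
qed

section \<open>Integral symplectic matrices and their block relations\<close>

lemma of_int_matrix_mult:
  "(\<chi> i j. of_int ((A ** B) $ i $ j)) =
    ((\<chi> i j. of_int (A $ i $ j)) ** (\<chi> i j. of_int (B $ i $ j)) :: 'a::comm_ring_1 ^ 'n ^ 'm)"
  by (simp add: matrix_matrix_mult_def vec_eq_iff)

text \<open>The fact is known over fields; the entrywise embedding of the integers into the reals is
  multiplicative and injective, so it descends.\<close>

lemma int_matrix_left_right_inverse:
  fixes A B :: "int ^ 'n ^ 'n"
  assumes "A ** B = mat 1"
  shows "B ** A = mat 1"
proof -
  let ?r = "\<lambda>M :: int ^ 'n ^ 'n. (\<chi> i j. of_int (M $ i $ j)) :: real ^ 'n ^ 'n"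
  have r1: "?r (mat 1) = mat 1"
    by (simp add: mat_def vec_eq_iff)
  have "?r A ** ?r B = mat 1"
    using assms of_int_matrix_mult[of A B] r1 by metis
  then have "?r (B ** A) = ?r (mat 1)"
    unfolding of_int_matrix_mult r1 using matrix_left_right_inverse by blast
  then show ?thesis by (simp add: vec_eq_iff)
qed

lemma symp_J_square: "symp_J ** symp_J = - mat 1"
  by (simp add: vec_eq_iff forall_4 matrix_matrix_mult_def sum_4 symp_J_entry mat_def)

text \<open>The defining relation exhibits \<open>J G^T (-J)\<close> as a right inverse of
  \<open>G\<close>. It is then also a left inverse, and multiplying by \<open>J\<close> from the
  left turns this into \<open>G^T J G = J\<close>.\<close>

lemma transpose_in_Sp4Z:
  assumes "G \<in> Sp4Z"
  shows "transpose G \<in> Sp4Z"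
proof -
  have neg: "A ** (- B) = - (A ** B)" "(- A) ** B = - (A ** B)" for A B :: "int ^ 4 ^ 4"
    by (simp_all add: matrix_matrix_mult_def vec_eq_iff sum_negf)
  have "G ** (symp_J ** transpose G ** (- symp_J)) = - (G ** symp_J ** transpose G ** symp_J)"
    by (simp add: neg matrix_mul_assoc)
  also have "\<dots> = mat 1"
    using assms by (simp add: Sp4Z_def symp_J_square)
  finally have "symp_J ** transpose G ** (- symp_J) ** G = mat 1"
    by (rule int_matrix_left_right_inverse)
  then have "symp_J ** (symp_J ** transpose G ** (- symp_J) ** G) = symp_J"
    by simp
  then have "transpose G ** symp_J ** G = symp_J"
    by (simp add: neg matrix_mul_assoc symp_J_square)
  then show ?thesis by (simp add: Sp4Z_def)
qed

text \<open>These are the blocks of \<open>G^T J G = J\<close>. The definition has the transpose on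
  the other side, which is why the transposed element is used.\<close>

lemma Sp4Z_blocks:
  assumes "G \<in> Sp4Z"
  defines "A \<equiv> block G 1 2 1 2" and "B \<equiv> block G 1 2 3 4"
    and "C \<equiv> block G 3 4 1 2" and "D \<equiv> block G 3 4 3 4"
  shows "transpose A ** C = transpose C ** A" "transpose B ** D = transpose D ** B"
    "transpose D ** A = mat 1 + transpose B ** C"
    "transpose A ** D = mat 1 + transpose C ** B"
proof -
  have GJG: "transpose G ** symp_J ** G = symp_J"
    using transpose_in_Sp4Z[OF assms(1)] by (simp add: Sp4Z_def)
  have "(transpose G ** symp_J ** G) $ i $ j = G $ 1 $ i * G $ 3 $ j
      + G $ 2 $ i * G $ 4 $ j - G $ 3 $ i * G $ 1 $ j - G $ 4 $ i * G $ 2 $ j" for i j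
    by (simp add: matrix_matrix_mult_def transpose_def sum_4 symp_J_entry)
  then have "of_int (symp_J $ i $ j) = (of_int (G $ 1 $ i * G $ 3 $ j
      + G $ 2 $ i * G $ 4 $ j - G $ 3 $ i * G $ 1 $ j - G $ 4 $ i * G $ 2 $ j) :: complex)" for i j
    unfolding GJG by (rule arg_cong)
  then have e: "of_int (G $ 1 $ i) * of_int (G $ 3 $ j) + of_int (G $ 2 $ i) * of_int (G $ 4 $ j)
      = (of_int (symp_J $ i $ j) + of_int (G $ 3 $ i) * of_int (G $ 1 $ j)
      + of_int (G $ 4 $ i) * of_int (G $ 2 $ j) :: complex)" for i j
    by simp
  have one_neq_2: "((1 :: 2) = 1) = True" "((2 :: 2) = 2) = True" "((1 :: 2) = 2) = False"
    "((2 :: 2) = 1) = False"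
    by simp_all
  note expand = matrix_eq_2x2 matrix_mult_2x2 transpose_def mat_def block_def
    A_def B_def C_def D_def
  have e': "of_int (G $ 1 $ 1) * of_int (G $ 3 $ 2) + of_int (G $ 2 $ 1) * of_int (G $ 4 $ 2)
      = (of_int (G $ 3 $ 1) * of_int (G $ 1 $ 2) + of_int (G $ 4 $ 1) * of_int (G $ 2 $ 2) :: complex)"
    "of_int (G $ 1 $ 3) * of_int (G $ 3 $ 4) + of_int (G $ 2 $ 3) * of_int (G $ 4 $ 4)
      = (of_int (G $ 3 $ 3) * of_int (G $ 1 $ 4) + of_int (G $ 4 $ 3) * of_int (G $ 2 $ 4) :: complex)"
    using e[of 1 2] e[of 3 4] by (simp_all add: symp_J_entry)
  have e'': "of_int (G $ 1 $ 1) * of_int (G $ 3 $ 3) + of_int (G $ 2 $ 1) * of_int (G $ 4 $ 3)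
      = (1 + of_int (G $ 3 $ 1) * of_int (G $ 1 $ 3) + of_int (G $ 4 $ 1) * of_int (G $ 2 $ 3) :: complex)"
    "of_int (G $ 1 $ 1) * of_int (G $ 3 $ 4) + of_int (G $ 2 $ 1) * of_int (G $ 4 $ 4)
      = (of_int (G $ 3 $ 1) * of_int (G $ 1 $ 4) + of_int (G $ 4 $ 1) * of_int (G $ 2 $ 4) :: complex)"
    "of_int (G $ 1 $ 2) * of_int (G $ 3 $ 3) + of_int (G $ 2 $ 2) * of_int (G $ 4 $ 3)
      = (of_int (G $ 3 $ 2) * of_int (G $ 1 $ 3) + of_int (G $ 4 $ 2) * of_int (G $ 2 $ 3) :: complex)"
    "of_int (G $ 1 $ 2) * of_int (G $ 3 $ 4) + of_int (G $ 2 $ 2) * of_int (G $ 4 $ 4)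
      = (1 + of_int (G $ 3 $ 2) * of_int (G $ 1 $ 4) + of_int (G $ 4 $ 2) * of_int (G $ 2 $ 4) :: complex)"
    using e[of 1 3] e[of 1 4] e[of 2 3] e[of 2 4] by (simp_all add: symp_J_entry)
  show "transpose A ** C = transpose C ** A"
    by (simp only: expand vec_lambda_beta mat2_nth; intro conjI;
      use e'(1) in \<open>simp add: mult.commute\<close>)
  show "transpose B ** D = transpose D ** B"
    by (simp only: expand vec_lambda_beta mat2_nth; intro conjI;
      use e'(2) in \<open>simp add: mult.commute\<close>)
  show "transpose D ** A = mat 1 + transpose B ** C"
    by (simp only: expand vec_lambda_beta mat2_nth vector_add_component one_neq_2 if_True if_False;
      intro conjI; use e'' in \<open>simp add: mult.commute add.assoc\<close>)
  show "transpose A ** D = mat 1 + transpose C ** B"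
    by (simp only: expand vec_lambda_beta mat2_nth vector_add_component one_neq_2 if_True if_False;
      intro conjI; use e'' in \<open>simp add: mult.commute add.assoc\<close>)
qed

section \<open>The action near a fixed point\<close>

lemma matrix_add_rdistrib:
  "(A + B) ** (C :: 'a::semiring_1 ^ 'n ^ 'm) = A ** C + B ** C"
  by (simp add: matrix_matrix_mult_def vec_eq_iff sum.distrib distrib_right)

text \<open>For symmetric \<open>N\<close>, pairing the columns \<open>(N; 1)\<close> and
  \<open>(M; 1)\<close> through \<open>J\<close> gives \<open>N - M\<close>. Applying
  \<open>G\<close> to both preserves the pairing, and this is the identity, arranged without
  subtraction.\<close>

lemma siegel_act_identity:
  fixes M N :: "complex ^ 2 ^ 2"
  assumes G: "G \<in> Sp4Z" and M: "transpose M = M" and N: "transpose N = N"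
  defines "A \<equiv> block G 1 2 1 2" and "B \<equiv> block G 1 2 3 4"
    and "C \<equiv> block G 3 4 1 2" and "D \<equiv> block G 3 4 3 4"
  shows "transpose (C ** N + D) ** (A ** M + B) + N
    = transpose (A ** N + B) ** (C ** M + D) + M"
proof -
  note rel = Sp4Z_blocks[OF G, folded A_def B_def C_def D_def]
  have "transpose (C ** N + D) ** (A ** M + B) =
      N ** (transpose C ** A) ** M + N ** (transpose C ** B) + (transpose D ** A) ** M + transpose D ** B"
    by (simp add: transpose_add matrix_transpose_mul N matrix_add_ldistrib matrix_add_rdistrib
        matrix_mul_assoc add_ac)
  moreover have "transpose (A ** N + B) ** (C ** M + D) =
      N ** (transpose A ** C) ** M + N ** (transpose A ** D) + (transpose B ** C) ** M + transpose B ** D"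
    by (simp add: transpose_add matrix_transpose_mul N matrix_add_ldistrib matrix_add_rdistrib
        matrix_mul_assoc add_ac)
  ultimately show ?thesis
    by (simp add: rel matrix_add_ldistrib matrix_add_rdistrib add_ac)
qed

lemma siegel_act_mult:
  assumes "det (block G 3 4 1 2 ** M + block G 3 4 3 4) \<noteq> 0"
  shows "siegel_act G M ** (block G 3 4 1 2 ** M + block G 3 4 3 4)
    = block G 1 2 1 2 ** M + block G 1 2 3 4"
  using matrix_inv_det_nz(2)[OF assms]
  by (simp add: siegel_act_def Let_def flip: matrix_mul_assoc)

text \<open>With both points equal, the identity says that \<open>Q^T P\<close> is symmetric, where
  \<open>P = (G . M) Q\<close>. Cancelling \<open>Q^T\<close> on the left and \<open>Q\<close> on
  the right leaves the symmetry of \<open>G . M\<close>.\<close>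

lemma transpose_siegel_act:
  assumes G: "G \<in> Sp4Z" and M: "transpose M = M"
    and nz: "det (block G 3 4 1 2 ** M + block G 3 4 3 4) \<noteq> 0"
  shows "transpose (siegel_act G M) = siegel_act G M"
proof -
  let ?Q = "block G 3 4 1 2 ** M + block G 3 4 3 4"
  let ?P = "block G 1 2 1 2 ** M + block G 1 2 3 4"
  have "transpose ?Q ** ?P = transpose ?P ** ?Q"
    using siegel_act_identity[OF G M M] by simp
  then have "transpose ?Q ** (siegel_act G M ** ?Q) = transpose ?Q ** (transpose (siegel_act G M) ** ?Q)"
    unfolding siegel_act_mult[OF nz, symmetric] by (simp add: matrix_transpose_mul matrix_mul_assoc)
  then show ?thesis
    using nz by (simp add: matrix_mult_left_cancel matrix_mult_right_cancel det_transpose)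
qed

text \<open>The two-point identity with \<sigma> as second point. It is exact rather than
  first-order, so the derivative of the action at \<sigma> can be read off from continuity of
  \<open>Q\<close> alone, without differentiating an inverse matrix.\<close>

lemma siegel_act_diff:
  fixes \<sigma> :: "complex ^ 2 ^ 2"
  assumes G: "G \<in> Sp4Z" and M: "transpose M = M" and \<sigma>: "transpose \<sigma> = \<sigma>"
  defines "Q \<equiv> \<lambda>M. block G 3 4 1 2 ** M + block G 3 4 3 4"
  assumes nz: "det (Q M) \<noteq> 0"
    and fixed: "block G 1 2 1 2 ** \<sigma> + block G 1 2 3 4 = \<sigma> ** Q \<sigma>"
  shows "transpose (Q \<sigma>) ** (siegel_act G M - \<sigma>) ** Q M = M - \<sigma>"
proof -
  have eq: "transpose (Q \<sigma>) ** (siegel_act G M ** Q M) + \<sigma> = transpose (\<sigma> ** Q \<sigma>) ** Q M + M"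
    using siegel_act_identity[OF G M \<sigma>] siegel_act_mult[OF nz[unfolded Q_def]] fixed
    unfolding Q_def by simp
  have "transpose (Q \<sigma>) ** (siegel_act G M - \<sigma>) ** Q M
    = transpose (Q \<sigma>) ** (siegel_act G M ** Q M) - transpose (\<sigma> ** Q \<sigma>) ** Q M"
  proof -
    have "transpose (Q \<sigma>) ** (siegel_act G M - \<sigma> + \<sigma>) ** Q M
      = transpose (Q \<sigma>) ** (siegel_act G M - \<sigma>) ** Q M + transpose (Q \<sigma>) ** \<sigma> ** Q M"
      by (simp only: matrix_add_ldistrib matrix_add_rdistrib)
    then show ?thesis
      by (simp add: matrix_transpose_mul \<sigma> matrix_mul_assoc)
  qed
  also have "\<dots> = M - \<sigma>"
    using eq by (simp add: algebra_simps)
  finally show ?thesis .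
qed

section \<open>The derivative at a fixed point and its vanishing\<close>

lemma scaleR_matrix_mult:
  fixes A B :: "complex ^ 2 ^ 2"
  shows "(r *\<^sub>R A) ** B = r *\<^sub>R (A ** B)" "A ** (r *\<^sub>R B) = r *\<^sub>R (A ** B)"
  by (simp_all add: matrix_eq_2x2 matrix_mult_2x2 algebra_simps)

text \<open>Caratheodory's form of the derivative: the difference quotient is the factor
  \<open>f\<close>, which only has to converge.\<close>

lemma has_vector_derivative_scaleR_at_0:
  fixes f :: "real \<Rightarrow> 'a::real_normed_vector"
  assumes "(f \<longlongrightarrow> D) (at 0)"
    and g: "\<forall>\<^sub>F t in at 0. g t = g 0 + t *\<^sub>R f t"
  shows "(g has_vector_derivative D) (at 0)"
proof -
  have "((\<lambda>t. norm (f t - D)) \<longlongrightarrow> 0) (at 0)"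
    using assms(1) by (simp add: LIM_zero tendsto_norm_zero)
  then have "((\<lambda>t. norm (g t - g 0 - t *\<^sub>R D) / norm t) \<longlongrightarrow> 0) (at 0)"
  proof (rule Lim_transform_eventually)
    show "\<forall>\<^sub>F t in at 0. norm (f t - D) = norm (g t - g 0 - t *\<^sub>R D) / norm t"
      using g eventually_neq_at_within[of 0]
    proof eventually_elim
      case (elim t)
      then have "g t - g 0 - t *\<^sub>R D = t *\<^sub>R (f t - D)"
        by (simp add: algebra_simps)
      with elim show ?case by simp
    qed
  qed
  then show ?thesis
    unfolding has_vector_derivative_def has_derivative_at
    by (simp add: bounded_linear_scaleR_left)
qed

text \<open>The half-space has empty interior among all 2x2 matrices, so \<open>F\<close> has a
  derivative only within it. The chain rule therefore needs a curve that stays in the half-space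
  near 0, which symmetry and openness provide.\<close>

lemma has_vector_derivative_along_curve:
  assumes F: "(F has_derivative L) (at \<sigma> within siegel_H2)" and \<sigma>: "\<sigma> \<in> siegel_H2"
    and \<gamma>: "(\<gamma> has_vector_derivative H) (at 0)" "\<gamma> 0 = \<sigma>"
    and sym: "\<forall>\<^sub>F t in at (0 :: real). transpose (\<gamma> t) = \<gamma> t"
  shows "((\<lambda>t. F (\<gamma> t)) has_vector_derivative L H) (at 0)"
proof -
  have "(\<gamma> \<longlongrightarrow> \<sigma>) (at 0)"
    using has_vector_derivative_continuous[OF \<gamma>(1)] \<gamma>(2) by (simp add: continuous_at)
  from eventually_in_siegel_H2[OF this \<sigma> sym]
  \<comment> \<open>The filter \<open>at 0\<close> omits 0 itself; the value \<sigma> fills this gap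
    and gives an open neighbourhood.\<close>
  have "\<forall>\<^sub>F t in nhds 0. \<gamma> t \<in> siegel_H2"
    unfolding eventually_at_filter
  proof eventually_elim
    case (elim t)
    then show ?case using \<sigma> \<gamma>(2) by (cases "t = 0") auto
  qed
  then obtain U where U: "open U" "0 \<in> U" "\<And>t. t \<in> U \<Longrightarrow> \<gamma> t \<in> siegel_H2"
    unfolding eventually_nhds by blast
  have "((F \<circ> \<gamma>) has_vector_derivative L H) (at 0 within U)"
  proof (rule vector_derivative_diff_chain_within)
    show "(\<gamma> has_vector_derivative H) (at 0 within U)"
      using \<gamma>(1) by (rule has_vector_derivative_at_within)
    show "(F has_derivative L) (at (\<gamma> 0) within \<gamma> ` U)"
      unfolding \<gamma>(2) by (rule has_derivative_subset[OF F]) (use U in auto)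
  qed
  then show ?thesis
    unfolding at_within_open[OF U(2,1)] o_def .
qed

text \<open>Along a curve through \<sigma> and along its image under \<open>G\<close>,
  \<open>F\<close> takes the same values. The two sides of the conclusion are the derivative at 0
  computed along each, and derivatives are unique.\<close>

lemma derivative_at_siegel_fixed_point:
  fixes F :: "complex ^ 2 ^ 2 \<Rightarrow> complex" and K :: "complex ^ 2 ^ 2"
  assumes F: "(F has_derivative L) (at \<sigma> within siegel_H2)" and \<sigma>: "\<sigma> \<in> siegel_H2"
    and invariant: "\<And>M. M \<in> siegel_H2 \<Longrightarrow> F (siegel_act G M) = F M"
    and G: "G \<in> Sp4Z"
  defines "Q \<equiv> block G 3 4 1 2 ** \<sigma> + block G 3 4 3 4"
  assumes nz: "det Q \<noteq> 0"
    and fixed: "block G 1 2 1 2 ** \<sigma> + block G 1 2 3 4 = \<sigma> ** Q"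
    and K: "transpose K = K"
  shows "L (transpose Q ** K ** Q) = L K"
proof -
  have sym: "transpose \<sigma> = \<sigma>" using \<sigma> by (simp add: siegel_H2_iff)
  \<comment> \<open>Moving from \<open>\<sigma>\<close> in the direction \<open>Q\<^sup>T K Q\<close> makes the image under \<open>G\<close> move in the direction \<open>K\<close>.\<close>
  define H where "H = transpose Q ** K ** Q"
  define \<gamma> where "\<gamma> = (\<lambda>t. \<sigma> + t *\<^sub>R H)"
  define q where "q = (\<lambda>t. block G 3 4 1 2 ** \<gamma> t + block G 3 4 3 4)"
  have symH: "transpose H = H"
    by (simp add: H_def matrix_transpose_mul K matrix_mul_assoc)
  have sym\<gamma>: "transpose (\<gamma> t) = \<gamma> t" for t
    by (simp add: \<gamma>_def transpose_add transpose_scalar sym symH)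
  have \<gamma>0: "\<gamma> 0 = \<sigma>" by (simp add: \<gamma>_def)
  have \<gamma>': "(\<gamma> has_vector_derivative H) (at 0)"
    unfolding \<gamma>_def by (auto intro!: derivative_eq_intros)
  have lim\<gamma>: "(\<gamma> \<longlongrightarrow> \<sigma>) (at 0)"
    using has_vector_derivative_continuous[OF \<gamma>'] \<gamma>0 by (simp add: continuous_at)
  have limq: "(q \<longlongrightarrow> Q) (at 0)"
    unfolding q_def Q_def by (intro tendsto_intros tendsto_matrix_mult lim\<gamma>)
  have ev: "\<forall>\<^sub>F t in at 0. det (q t) \<noteq> 0"
    by (rule tendsto_imp_eventually_ne[OF _ nz])
       (unfold det_2, intro tendsto_intros limq)
  have fixed': "siegel_act G \<sigma> = \<sigma>"
    using siegel_act_mult[of G \<sigma>] nz fixed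
    by (simp add: Q_def[symmetric] matrix_mult_right_cancel)
  \<comment> \<open>By \<open>siegel_act_diff\<close>, the displacement of the image, multiplied by
    \<open>Q^T\<close> on the left and \<open>q t\<close> on the right, is \<open>t Q^T K Q\<close>;
    both outer factors can be cancelled.\<close>
  have \<psi>: "siegel_act G (\<gamma> t) = siegel_act G (\<gamma> 0) + t *\<^sub>R (K ** Q ** matrix_inv (q t))"
    if "det (q t) \<noteq> 0" for t
  proof -
    have "transpose Q ** (siegel_act G (\<gamma> t) - \<sigma>) ** q t = \<gamma> t - \<sigma>"
      using siegel_act_diff[OF G sym\<gamma> sym] that fixed unfolding q_def Q_def by simp
    also have "\<dots> = transpose Q ** (t *\<^sub>R (K ** Q ** matrix_inv (q t))) ** q t"
      using matrix_inv_det_nz(2)[OF that]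
      by (simp add: \<gamma>_def H_def scaleR_matrix_mult flip: matrix_mul_assoc)
    finally have "siegel_act G (\<gamma> t) - \<sigma> = t *\<^sub>R (K ** Q ** matrix_inv (q t))"
      using nz that by (simp add: matrix_mult_left_cancel matrix_mult_right_cancel det_transpose)
    then show ?thesis by (simp add: \<gamma>0 fixed' algebra_simps)
  qed
  have "((\<lambda>t. K ** Q ** matrix_inv (q t)) \<longlongrightarrow> K ** Q ** matrix_inv Q) (at 0)"
    by (intro tendsto_matrix_mult tendsto_const tendsto_matrix_inv_2x2 limq nz)
  moreover have "K ** Q ** matrix_inv Q = K"
    using matrix_inv_det_nz(1)[OF nz] by (simp flip: matrix_mul_assoc)
  ultimately have \<psi>': "((\<lambda>t. siegel_act G (\<gamma> t)) has_vector_derivative K) (at 0)"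
    by (intro has_vector_derivative_scaleR_at_0[where f = "\<lambda>t. K ** Q ** matrix_inv (q t)"])
       (use ev \<psi> in \<open>auto elim: eventually_mono\<close>)
  have sym\<psi>: "\<forall>\<^sub>F t in at 0. transpose (siegel_act G (\<gamma> t)) = siegel_act G (\<gamma> t)"
    using ev by eventually_elim (rule transpose_siegel_act[OF G sym\<gamma>], simp add: q_def)
  have K': "((\<lambda>t. F (siegel_act G (\<gamma> t))) has_vector_derivative L K) (at 0)"
    using has_vector_derivative_along_curve[OF F \<sigma> \<psi>' _ sym\<psi>] \<gamma>0 fixed' by simp
  have "((\<lambda>t. F (\<gamma> t)) has_vector_derivative L H) (at 0)"
    using has_vector_derivative_along_curve[OF F \<sigma> \<gamma>' \<gamma>0] sym\<gamma> by simp
  moreover have "\<forall>\<^sub>F t in nhds 0. F (\<gamma> t) = F (siegel_act G (\<gamma> t))"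
  proof -
    have "\<forall>\<^sub>F t in at 0. \<gamma> t \<in> siegel_H2"
      using eventually_in_siegel_H2[OF lim\<gamma> \<sigma>] sym\<gamma> by simp
    then show ?thesis
      unfolding eventually_at_filter
    proof eventually_elim
      case (elim t)
      then show ?case using \<gamma>0 fixed' by (cases "t = 0") (auto simp: invariant)
    qed
  qed
  ultimately have "((\<lambda>t. F (siegel_act G (\<gamma> t))) has_vector_derivative L H) (at 0)"
    using has_vector_derivative_cong_ev[of UNIV "\<lambda>t. F (\<gamma> t)" "\<lambda>t. F (siegel_act G (\<gamma> t))" 0]
    by (simp add: \<gamma>0 fixed')
  with K' show ?thesis
    unfolding H_def[symmetric] by (metis vector_derivative_at)
qed


text \<open>With the eigenvalues \<open>\<lambda>, \<mu>\<close> of \<open>Q\<close>, the non-degeneracy condition reads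
  \<open>(1 - \<lambda> \<mu>) (1 - \<lambda>\<^sup>2) (1 - \<mu>\<^sup>2) \<noteq> 0\<close>. Since \<open>L\<close> is only additive, scalars have to be kept inside \<open>L\<close>.\<close>

lemma congruence_invariant_vanishes:
  fixes L :: "complex ^ 2 ^ 2 \<Rightarrow> complex" and Q H :: "complex ^ 2 ^ 2"
  assumes add: "\<And>X Y. L (X + Y) = L X + L Y"
    and invariant: "\<And>K. transpose K = K \<Longrightarrow> L (transpose Q ** K ** Q) = L K"
    and nz: "(1 - det Q) * ((1 + det Q)\<^sup>2 - (trace Q)\<^sup>2) \<noteq> 0"
    and H: "transpose H = H"
  shows "L H = 0"
proof -
  define T where "T = (\<lambda>K. transpose Q ** K ** Q)"
  define sc :: "complex \<Rightarrow> complex ^ 2 ^ 2 \<Rightarrow> complex ^ 2 ^ 2"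
    where "sc = (\<lambda>c K. \<chi> i j. c * K $ i $ j)"
  define d s where "d = det Q" and "s = trace Q"
  define n where "n = (1 - d) * ((1 + d)\<^sup>2 - s\<^sup>2)"
  have n: "n \<noteq> 0" using nz by (simp add: n_def d_def s_def)
  have L0: "L 0 = 0" using add[of 0 0] by simp
  have symT: "transpose (T K) = T K" if "transpose K = K" for K
    by (simp add: T_def matrix_transpose_mul matrix_mul_assoc that)
  have symsc: "transpose (sc c K) = sc c K" if "transpose K = K" for c K
    using that by (simp add: symmetric_2x2_iff sc_def)
  have Tsc: "sc c (T K) = T (sc c K)" for c K
    by (simp add: matrix_eq_2x2 sc_def T_def matrix_mult_2x2 algebra_simps)
  have LT: "L (T K) = L K" if "transpose K = K" for K
    unfolding T_def by (rule invariant[OF that])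
  have LT1: "L (sc c (T K)) = L (sc c K)" if "transpose K = K" for c K
    by (simp add: Tsc LT symsc that)
  have split: "L (sc (a + b) K) = L (sc a K) + L (sc b K)" for a b K
    by (simp add: sc_def distrib_right flip: add) (simp add: plus_vec_def)
  \<comment> \<open>In terms of the eigenvalues of \<open>Q\<close>, \<open>e\<close> is the sum of
    their squares.\<close>
  define e where "e = s\<^sup>2 - 2 * d"
  \<comment> \<open>Complex factors cannot be moved out of \<open>L\<close>, so the coefficients are
    divided by \<open>n\<close> beforehand; they then sum to 1.\<close>
  define u where "u = (\<lambda>c. c / n)"
  \<comment> \<open>Cayley-Hamilton for \<open>T\<close> on symmetric matrices: its characteristic polynomial is
    \<open>p(x) = (x - d) (x\<^sup>2 - e x + d\<^sup>2)\<close>, and \<open>n = p(1)\<close>.\<close>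
  have "sc (u 1) (T (T (T H))) + sc (u (- (e + d))) (T (T H)) + sc (u (d\<^sup>2 + e * d)) (T H)
    + sc (u (- (d ^ 3))) H = 0"
  proof -
    obtain p q r t where Q: "Q $ 1 $ 1 = p" "Q $ 1 $ 2 = q" "Q $ 2 $ 1 = r" "Q $ 2 $ 2 = t"
      by blast
    have d: "d = p * t - q * r" and s: "s = p + t"
      by (simp_all add: d_def s_def det_2 trace_def sum_2 Q)
    \<comment> \<open>Cayley-Hamilton for \<open>Q\<close> itself expresses \<open>N (T K)\<close>
      and \<open>T (T K)\<close> through \<open>K\<close>, \<open>N K\<close> and
      \<open>T K\<close>. Eliminating \<open>N\<close> leaves the cubic relation for
      \<open>T\<close>.\<close>
    define N where "N = (\<lambda>K. transpose Q ** K + K ** Q)"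
    have NT: "N (T K) $ i $ j = 2 * s * T K $ i $ j - d * N K $ i $ j" for K i j
    proof -
      have "\<forall>i j. N (T K) $ i $ j = 2 * s * T K $ i $ j - d * N K $ i $ j"
        unfolding forall_2
        by (simp add: N_def T_def matrix_mult_2x2 transpose_def Q d s algebra_simps)
      then show ?thesis by blast
    qed
    have TT: "T (T K) $ i $ j = s\<^sup>2 * T K $ i $ j - s * d * N K $ i $ j + d\<^sup>2 * K $ i $ j" for K i j
    proof -
      have "\<forall>i j. T (T K) $ i $ j = s\<^sup>2 * T K $ i $ j - s * d * N K $ i $ j + d\<^sup>2 * K $ i $ j"
        unfolding forall_2
        by (simp add: N_def T_def matrix_mult_2x2 transpose_def Q d s power2_eq_square algebra_simps)
      then show ?thesis by blast
    qed
    have "T (T (T H)) $ i $ j - (e + d) * T (T H) $ i $ j + (d\<^sup>2 + e * d) * T H $ i $ j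
      - d ^ 3 * H $ i $ j = 0" for i j
      unfolding TT[of "T H"] NT TT[of H] e_def
      by (simp add: power2_eq_square power3_eq_cube algebra_simps)
    then have "(T (T (T H)) $ i $ j - (e + d) * T (T H) $ i $ j + (d\<^sup>2 + e * d) * T H $ i $ j
      - d ^ 3 * H $ i $ j) / n = 0" for i j
      by simp
    then show ?thesis
      by (simp add: vec_eq_iff sc_def u_def diff_divide_distrib add_divide_distrib
          algebra_simps)
  qed
  then have "0 = L (sc (u 1) (T (T (T H)))) + L (sc (u (- (e + d))) (T (T H)))
    + L (sc (u (d\<^sup>2 + e * d)) (T H)) + L (sc (u (- (d ^ 3))) H)"
    by (simp add: L0 flip: add)
  \<comment> \<open>Under \<open>L\<close> every \<open>T\<close> may be dropped, so the polynomial
    in \<open>T\<close> is evaluated at 1.\<close>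
  also have "\<dots> = L (sc (u 1 + u (- (e + d)) + u (d\<^sup>2 + e * d) + u (- (d ^ 3))) H)"
    by (simp add: LT1 symT H split)
  also have "u 1 + u (- (e + d)) + u (d\<^sup>2 + e * d) + u (- (d ^ 3)) = 1"
  proof -
    have "1 + - (e + d) + (d\<^sup>2 + e * d) + - (d ^ 3) = n"
      unfolding n_def e_def by algebra
    then show ?thesis
      using n by (simp add: u_def flip: add_divide_distrib diff_divide_distrib)
  qed
  also have "sc 1 H = H" by (simp add: sc_def)
  finally show ?thesis by simp
qed

text \<open>This reduces each point to one explicit \<open>G\<close> and a computation with the
  determinant and trace of \<open>Q\<close>. The derivative vanishes on all symmetric directions,
  and only those enter \<open>dM\<close>.\<close>

lemma siegel_fixed_point_critical:
  fixes F :: "complex ^ 2 ^ 2 \<Rightarrow> complex"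
  assumes F: "F differentiable_on siegel_H2"
    and modular: "\<And>\<Gamma> M. \<Gamma> \<in> Sp4Z \<Longrightarrow> M \<in> siegel_H2 \<Longrightarrow> F (siegel_act \<Gamma> M) = F M"
    and \<sigma>: "\<sigma> \<in> siegel_H2" and G: "G \<in> Sp4Z"
    and Q: "block G 3 4 1 2 ** \<sigma> + block G 3 4 3 4 = Q"
    and fixed: "block G 1 2 1 2 ** \<sigma> + block G 1 2 3 4 = \<sigma> ** Q"
    and nz: "det Q \<noteq> 0" "(1 - det Q) * ((1 + det Q)\<^sup>2 - (trace Q)\<^sup>2) \<noteq> 0"
  shows "dM F \<sigma> = 0"
proof -
  obtain L where L: "(F has_derivative L) (at \<sigma> within siegel_H2)"
    using F \<sigma> unfolding differentiable_on_def differentiable_def by blast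
  have L0: "L H = 0" if "transpose H = H" for H
  proof (rule congruence_invariant_vanishes[OF _ _ nz(2) that])
    show "L (X + Y) = L X + L Y" for X Y
      using has_derivative_linear[OF L] by (rule linear_add)
    show "L (transpose Q ** K ** Q) = L K" if "transpose K = K" for K
      using derivative_at_siegel_fixed_point[OF L \<sigma> modular[OF G] G] Q fixed nz(1) that by simp
  qed
  have line: "vector_derivative (\<lambda>t. F (\<sigma> + t *\<^sub>R H)) (at 0) = 0" if "transpose H = H" for H
  proof -
    have "((\<lambda>t. \<sigma> + t *\<^sub>R H) has_vector_derivative H) (at 0)"
      by (auto intro!: derivative_eq_intros)
    then have "((\<lambda>t. F (\<sigma> + t *\<^sub>R H)) has_vector_derivative L H) (at 0)"
      by (rule has_vector_derivative_along_curve[OF L \<sigma>])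
         (use \<sigma> that in \<open>auto simp: siegel_H2_iff transpose_add transpose_scalar\<close>)
    with L0[OF that] show ?thesis by (simp add: vector_derivative_at)
  qed
  have \<sigma>21: "\<sigma> $ 2 $ 1 = \<sigma> $ 1 $ 2"
    using \<sigma> by (simp add: siegel_H2_iff symmetric_2x2_iff)
  \<comment> \<open>A Wirtinger derivative combines the derivatives along a symmetric direction and
    along \<i> times it; both are needed as \<open>L\<close> is only real linear. The triples
    \<open>(p, q, r)\<close> used below select the entries \<open>T\<close>, \<open>Z\<close> and
    \<open>U\<close>.\<close>
  have wirtinger: "wirtinger (\<lambda>z. F (h z)) w = 0"
    if "\<And>z. h (w + z) = \<sigma> + mat2 (p * z) (q * z) (q * z) (r * z)" for h w p q r
  proof -
    have "h (w + of_real t) = \<sigma> + t *\<^sub>R mat2 p q q r"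
      "h (w + \<i> * of_real t) = \<sigma> + t *\<^sub>R mat2 (\<i> * p) (\<i> * q) (\<i> * q) (\<i> * r)" for t
      unfolding that by (simp_all add: matrix_eq_2x2, simp_all add: scaleR_conv_of_real)
    moreover have "transpose (mat2 a b b c) = mat2 a b b c" for a b c :: complex
      by (simp add: symmetric_2x2_iff)
    ultimately show ?thesis
      using line by (simp add: wirtinger_def)
  qed
  have "wirtinger (\<lambda>t. F (mat2 t (\<sigma> $ 1 $ 2) (\<sigma> $ 1 $ 2) (\<sigma> $ 2 $ 2))) (\<sigma> $ 1 $ 1) = 0"
    by (rule wirtinger[of _ _ 1 0 0]) (simp add: matrix_eq_2x2 \<sigma>21)
  moreover have "wirtinger (\<lambda>z. F (mat2 (\<sigma> $ 1 $ 1) z z (\<sigma> $ 2 $ 2))) (\<sigma> $ 1 $ 2) = 0"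
    by (rule wirtinger[of _ _ 0 1 0]) (simp add: matrix_eq_2x2 \<sigma>21)
  moreover have "wirtinger (\<lambda>u. F (mat2 (\<sigma> $ 1 $ 1) (\<sigma> $ 1 $ 2) (\<sigma> $ 1 $ 2) u)) (\<sigma> $ 2 $ 2) = 0"
    by (rule wirtinger[of _ _ 0 0 1]) (simp add: matrix_eq_2x2 \<sigma>21)
  ultimately show ?thesis
    by (simp add: dM_def Let_def matrix_eq_2x2)
qed

section \<open>Explicit matrices and roots of unity\<close>

lemma vector_4:
  "(vector [a, b, c, d] :: 'a::zero ^ 4) $ 1 = a" "(vector [a, b, c, d] :: 'a ^ 4) $ 2 = b"
  "(vector [a, b, c, d] :: 'a ^ 4) $ 3 = c" "(vector [a, b, c, d] :: 'a ^ 4) $ 4 = d"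
  by (simp_all add: vector_def)

lemmas Sp4Z_simps = Sp4Z_def vec_eq_iff forall_4 matrix_matrix_mult_def sum_4 transpose_def
  symp_J_entry vector_4

lemmas block_simps = block_def vector_4 matrix_eq_2x2 matrix_mult_2x2

lemma mat2_in_siegel_H2_iff:
  "mat2 a b b c \<in> siegel_H2 \<longleftrightarrow> 0 < Im a \<and> (Im b)\<^sup>2 < Im a * Im c"
  by (simp add: siegel_H2_iff symmetric_2x2_iff)

lemma det_mat2: "det (mat2 a b c d) = a * d - b * (c :: 'a::comm_ring_1)"
  by (simp add: det_2)

lemma trace_mat2: "trace (mat2 a b c d) = a + (d :: 'a::comm_ring_1)"
  by (simp add: trace_def sum_2)

lemma zeta5_cis: "zeta5 = cis (2 * pi / 5)"
  by (simp add: zeta5_def cis_conv_exp mult_ac)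

lemma zeta5_Re_Im: "0 < Re zeta5" "0 < Im zeta5"
  by (auto simp: zeta5_cis intro!: cos_gt_zero sin_gt_zero)

lemma zeta5_cyclotomic: "1 + zeta5 + zeta5\<^sup>2 + zeta5 ^ 3 + zeta5 ^ 4 = 0"
proof -
  have "zeta5 ^ 5 = 1"
    unfolding zeta5_cis by (subst Complex.DeMoivre) simp
  then have "(zeta5 - 1) * (1 + zeta5 + zeta5\<^sup>2 + zeta5 ^ 3 + zeta5 ^ 4) = 0"
    by algebra
  moreover have "zeta5 \<noteq> 1"
    using zeta5_Re_Im by auto
  ultimately show ?thesis by simp
qed

lemma rho_cis: "rho = cis (2 * pi / 3)"
  by (simp add: rho_def cis_conv_exp mult_ac)

lemma rho_Im: "0 < Im rho"
  by (auto simp: rho_cis intro!: sin_gt_zero)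

lemma rho_cyclotomic: "1 + rho + rho\<^sup>2 = 0"
proof -
  have "rho ^ 3 = 1"
    unfolding rho_cis by (subst Complex.DeMoivre) simp
  then have "(rho - 1) * (1 + rho + rho\<^sup>2) = 0"
    by algebra
  moreover have "rho \<noteq> 1"
    using rho_Im by auto
  ultimately show ?thesis by simp
qed

lemma rho_ne: "rho \<noteq> 0" "rho \<noteq> 1" "rho \<noteq> - 1"
  using rho_Im by (auto dest: arg_cong[of _ _ Im])

section \<open>The six fixed points\<close>

context
  fixes F :: "complex ^ 2 ^ 2 \<Rightarrow> complex"
  assumes differentiable: "F differentiable_on siegel_H2"
    and modular: "\<And>\<Gamma> M. \<Gamma> \<in> Sp4Z \<Longrightarrow> M \<in> siegel_H2 \<Longrightarrow> F (siegel_act \<Gamma> M) = F M"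
begin

text \<open>The stabiliser elements \<open>G\<close> below were found by a computer search over entries in
  \<open>{-1, 0, 1}\<close>.\<close>

lemma dM_sigma1: "dM F sigma1 = 0"
proof -
  define z where "z = zeta5"
  define b where "b = z + z ^ 3"
  define G :: "int ^ 4 ^ 4" where "G = vector [vector [0, 1, 1, 1], vector [0, 0, 1, 0],
    vector [0, 0, 0, 1], vector [-1, 0, 0, -1]]"
  have cyc: "1 + z + z\<^sup>2 + z ^ 3 + z ^ 4 = 0"
    using zeta5_cyclotomic by (simp add: z_def)
  have z0: "z \<noteq> 0" and z1: "z \<noteq> 1"
    using zeta5_Re_Im by (auto simp: z_def)
  \<comment> \<open>Negative powers become polynomials, so that all later identities follow from the
    cyclotomic relation.\<close>
  have inv1: "inverse z = z ^ 4" and inv2: "inverse (z\<^sup>2) = z ^ 3"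
    by (rule inverse_unique, use cyc in algebra)+
  have conj: "cnj z = z ^ 4"
    unfolding inv1[symmetric] by (simp add: z_def zeta5_cis cis_cnj)
  have z3: "z ^ 3 = (cnj z)\<^sup>2"
    unfolding conj using cyc by algebra
  define x y where "x = Re z" and "y = Im z"
  have xy: "0 < x" "0 < y"
    using zeta5_Re_Im by (simp_all add: x_def y_def z_def)
  have norm: "x\<^sup>2 + y\<^sup>2 = 1"
    by (simp add: x_def y_def z_def zeta5_cis)
  have "x < 1"
  proof (rule power2_less_imp_less)
    have "0 < y\<^sup>2" using xy by simp
    then show "x\<^sup>2 < 1\<^sup>2" unfolding one_power2 using norm by linarith
  qed simp
  have Re3: "Re (z ^ 3) = x\<^sup>2 - y\<^sup>2" and Im3: "Im (z ^ 3) = - 2 * x * y" and Im4: "Im (z ^ 4) = - y"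
    by (simp_all add: z3 x_def y_def power2_eq_square flip: conj)
  have sigma1: "sigma1 = mat2 z b b (- (z ^ 4))"
    by (simp add: sigma1_def z_def[symmetric] b_def power_int_minus inv1 inv2)
  show ?thesis
    unfolding sigma1
  \<comment> \<open>By the cyclotomic relation, this \<open>Q\<close> has determinant
    \<open>z\<close> and trace \<open>z^2 + z^4\<close>, hence the eigenvalues \<open>z^2\<close>
    and \<open>z^4\<close>. The tangent eigenvalues are \<open>z^4\<close>, \<open>z\<close> and
    \<open>z^3\<close>.\<close>
  proof (rule siegel_fixed_point_critical[OF differentiable modular, where G = G
        and Q = "mat2 0 1 (- z) (- b - 1)"])
    have "Im b = y * (1 - 2 * x)"
      by (simp add: b_def Im3 y_def algebra_simps)
    moreover have "(1 - 2 * x)\<^sup>2 < 1"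
      using xy \<open>x < 1\<close> by (simp add: abs_square_less_1)
    ultimately show "mat2 z b b (- (z ^ 4)) \<in> siegel_H2"
      using xy by (simp add: mat2_in_siegel_H2_iff Im4 y_def[symmetric] power_mult_distrib
          power2_eq_square[of y])
    show "G \<in> Sp4Z" by (simp add: Sp4Z_simps G_def)
    show "block G 3 4 1 2 ** mat2 z b b (- (z ^ 4)) + block G 3 4 3 4 = mat2 0 1 (- z) (- b - 1)"
      by (simp add: block_simps G_def)
    show "block G 1 2 1 2 ** mat2 z b b (- (z ^ 4)) + block G 1 2 3 4
      = mat2 z b b (- (z ^ 4)) ** mat2 0 1 (- z) (- b - 1)"
    proof -
      have "b + 1 = - (b * z)" "1 - z ^ 4 = z + b * (- b - 1)" "z ^ 4 * z = 1"
        "b = z ^ 4 * (- b - 1)"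
        unfolding b_def using cyc by algebra+
      then show ?thesis by (simp add: block_simps G_def)
    qed
    show "det (mat2 0 1 (- z) (- b - 1)) \<noteq> 0"
      using z0 by (simp add: det_mat2)
    \<comment> \<open>The last factor of the non-degeneracy expression; the other factors are
      \<open>z - 1\<close> and \<open>z^3\<close>.\<close>
    have "0 < Re (2 + 2 * z + z ^ 3)"
    proof -
      have "Re (2 + 2 * z + z ^ 3) = 2 + 2 * x + (x\<^sup>2 - y\<^sup>2)"
        by (simp add: Re3 flip: x_def)
      also have "\<dots> = 1 + 2 * x + 2 * x\<^sup>2"
        using norm by simp
      finally have "Re (2 + 2 * z + z ^ 3) = 1 + 2 * x + 2 * x\<^sup>2" .
      moreover have "0 < 1 + 2 * x + 2 * x\<^sup>2"
        using xy by (simp add: add_pos_nonneg)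
      ultimately show ?thesis by metis
    qed
    then have "2 + 2 * z + z ^ 3 \<noteq> 0" by (metis less_irrefl zero_complex.sel(1))
    moreover have "(1 - z) * ((1 + z)\<^sup>2 - (- b - 1)\<^sup>2) = (z - 1) * z ^ 3 * (2 + 2 * z + z ^ 3)"
      unfolding b_def by algebra
    ultimately show "(1 - det (mat2 0 1 (- z) (- b - 1)))
      * ((1 + det (mat2 0 1 (- z) (- b - 1)))\<^sup>2 - (trace (mat2 0 1 (- z) (- b - 1)))\<^sup>2) \<noteq> 0"
      using z0 z1 by (simp add: det_mat2 trace_mat2)
  qed
qed

lemma dM_sigma2: "dM F sigma2 = 0"
proof -
  define b where "b = (1/2) * (eta - 1)"
  define Q where "Q = mat2 (- eta) (- b - 1) (eta - b - 1) (b - eta + 1)"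
  define G :: "int ^ 4 ^ 4" where "G = vector [vector [-1, 0, 1, 0], vector [0, 0, 0, 1],
    vector [-1, 0, 0, -1], vector [1, -1, -1, 1]]"
  have b: "eta = 2 * b + 1" by (simp add: b_def field_simps)
  have "3 * eta\<^sup>2 - 2 * eta + 3 = 0"
    by (simp add: eta_def complex_eq_iff power2_eq_square)
  then have eq: "3 * b\<^sup>2 + 2 * b + 1 = 0"
    unfolding b by algebra
  have Im: "0 < Im eta" "Im eta = 2 * Im b"
    by (simp_all add: eta_def b_def)
  \<comment> \<open>Determinant -1 and squared trace -2 mean that the eigenvalues are primitive
    eighth roots of unity; the non-degeneracy expression equals 4.\<close>
  have det: "det Q = - 1"
    using eq by (simp add: Q_def det_mat2 b) algebra
  have trace: "(trace Q)\<^sup>2 = - 2"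
    using eq by (simp add: Q_def trace_mat2 b) algebra
  show ?thesis
    unfolding sigma2_def b_def[symmetric]
  proof (rule siegel_fixed_point_critical[OF differentiable modular, where G = G and Q = Q])
    show "mat2 eta b b eta \<in> siegel_H2"
      using Im by (simp add: mat2_in_siegel_H2_iff power2_eq_square)
    show "G \<in> Sp4Z" by (simp add: Sp4Z_simps G_def)
    show "block G 3 4 1 2 ** mat2 eta b b eta + block G 3 4 3 4 = Q"
      by (simp add: block_simps G_def Q_def)
    show "block G 1 2 1 2 ** mat2 eta b b eta + block G 1 2 3 4 = mat2 eta b b eta ** Q"
      by (simp add: block_simps G_def Q_def b; (intro conjI)?; (algebra | (insert eq; algebra)))
  qed (simp_all add: det trace)
qed

lemma dM_sigma3: "dM F sigma3 = 0"
proof -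
  \<comment> \<open>This is \<open>J\<close>, acting by \<open>M \<mapsto> - M^-1\<close>; on the
    tangent space it acts as -1.\<close>
  define G :: "int ^ 4 ^ 4" where "G = vector [vector [0, 0, 1, 0], vector [0, 0, 0, 1],
    vector [-1, 0, 0, 0], vector [0, -1, 0, 0]]"
  show ?thesis
    unfolding sigma3_def
  proof (rule siegel_fixed_point_critical[OF differentiable modular, where G = G
        and Q = "mat2 (- \<i>) 0 0 (- \<i>)"])
    show "mat2 \<i> 0 0 \<i> \<in> siegel_H2"
      by (simp add: mat2_in_siegel_H2_iff)
    show "G \<in> Sp4Z" by (simp add: Sp4Z_simps G_def)
  qed (simp_all add: block_simps G_def det_mat2 trace_mat2 power2_eq_square)
qed

lemma dM_sigma4: "dM F sigma4 = 0"
proof -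
  define Q where "Q = mat2 (- rho - 1) 0 0 (- rho - 1)"
  \<comment> \<open>The action is \<open>M \<mapsto> - (M + 1)^-1\<close>, the analogue of the
    elliptic element of order 3 fixing \<open>rho\<close>. Here \<open>Q\<close> is the scalar
    \<open>rho^2\<close>, so the tangent action of \<open>Q\<close> is multiplication by
    \<open>rho\<close>.\<close>
  define G :: "int ^ 4 ^ 4" where "G = vector [vector [0, 0, 1, 0], vector [0, 0, 0, 1],
    vector [-1, 0, -1, 0], vector [0, -1, 0, -1]]"
  have det: "det Q = rho" and trace: "(trace Q)\<^sup>2 = 4 * rho"
    unfolding Q_def det_mat2 trace_mat2 using rho_cyclotomic by algebra+
  show ?thesis
    unfolding sigma4_def
  proof (rule siegel_fixed_point_critical[OF differentiable modular, where G = G and Q = Q])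
    show "mat2 rho 0 0 rho \<in> siegel_H2"
      using rho_Im by (simp add: mat2_in_siegel_H2_iff)
    show "G \<in> Sp4Z" by (simp add: Sp4Z_simps G_def)
    show "block G 3 4 1 2 ** mat2 rho 0 0 rho + block G 3 4 3 4 = Q"
      by (simp add: block_simps G_def Q_def)
    show "block G 1 2 1 2 ** mat2 rho 0 0 rho + block G 1 2 3 4 = mat2 rho 0 0 rho ** Q"
      by (simp add: block_simps G_def Q_def) (use rho_cyclotomic in algebra)
    have "(1 - rho) * ((1 + rho)\<^sup>2 - 4 * rho) = - 3 * rho * (1 - rho)"
      using rho_cyclotomic by algebra
    then show "(1 - det Q) * ((1 + det Q)\<^sup>2 - (trace Q)\<^sup>2) \<noteq> 0"
      using rho_ne by (simp add: det trace)
    show "det Q \<noteq> 0" unfolding det by (rule rho_ne)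
  qed
qed

lemma dM_sigma5: "dM F sigma5 = 0"
proof -
  define c where "c = \<i> / of_real (sqrt 3)"
  define Q where "Q = mat2 (- (c * 2)) (- c) c (- c)"
  \<comment> \<open>With the upper right block \<open>B\<close>, the action is
    \<open>M \<mapsto> - B M^-1 B^T\<close>: inversion followed by a unimodular change of
    basis.\<close>
  define G :: "int ^ 4 ^ 4" where "G = vector [vector [0, 0, 1, 1], vector [0, 0, 0, 1],
    vector [-1, 0, 0, 0], vector [1, -1, 0, 0]]"
  have eq: "3 * c\<^sup>2 = - 1"
    by (simp add: c_def power_divide flip: of_real_power)
  have Im: "0 < Im c"
    by (simp add: c_def)
  \<comment> \<open>The eigenvalues are a primitive sixth and a primitive third root of unity with
    product -1; the non-degeneracy expression equals 6.\<close>
  have det: "det Q = - 1" and trace: "(trace Q)\<^sup>2 = - 3"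
    unfolding Q_def det_mat2 trace_mat2 using eq by algebra+
  have sigma5: "sigma5 = mat2 (c * 2) c c (c * 2)"
    by (simp add: sigma5_def Let_def c_def)
  show ?thesis
    unfolding sigma5
  proof (rule siegel_fixed_point_critical[OF differentiable modular, where G = G and Q = Q])
    show "mat2 (c * 2) c c (c * 2) \<in> siegel_H2"
      using Im by (simp add: mat2_in_siegel_H2_iff power2_eq_square)
    show "G \<in> Sp4Z" by (simp add: Sp4Z_simps G_def)
    show "block G 3 4 1 2 ** mat2 (c * 2) c c (c * 2) + block G 3 4 3 4 = Q"
      by (simp add: block_simps G_def Q_def)
    show "block G 1 2 1 2 ** mat2 (c * 2) c c (c * 2) + block G 1 2 3 4
      = mat2 (c * 2) c c (c * 2) ** Q"
      by (simp add: block_simps G_def Q_def; (intro conjI)?; (algebra | (insert eq; algebra)))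
  qed (simp_all add: det trace)
qed

lemma dM_sigma6: "dM F sigma6 = 0"
proof -
  define Q where "Q = mat2 (- rho - 1) 0 0 (- \<i>)"
  \<comment> \<open>On diagonal matrices this acts in each coordinate separately: by the element of
    order 3 fixing \<open>rho\<close> and by inversion fixing \<i>. Thus \<open>Q\<close> is
    diagonal with entries \<open>rho^2\<close> and \<open>- \<i>\<close>.\<close>
  define G :: "int ^ 4 ^ 4" where "G = vector [vector [0, 0, 1, 0], vector [0, 0, 0, 1],
    vector [-1, 0, -1, 0], vector [0, -1, 0, 0]]"
  have rho2: "(1 + rho)\<^sup>2 = rho"
  proof -
    have "(1 + rho)\<^sup>2 = (1 + rho + rho\<^sup>2) + rho"
      by (simp add: power2_eq_square algebra_simps)
    then show ?thesis by (simp add: rho_cyclotomic)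
  qed
  have det: "det Q = \<i> * (1 + rho)" and trace: "trace Q = - rho - 1 - \<i>"
    by (simp_all add: Q_def det_mat2 trace_mat2 algebra_simps)
  show ?thesis
    unfolding sigma6_def
  proof (rule siegel_fixed_point_critical[OF differentiable modular, where G = G and Q = Q])
    show "mat2 rho 0 0 \<i> \<in> siegel_H2"
      using rho_Im by (simp add: mat2_in_siegel_H2_iff)
    show "G \<in> Sp4Z" by (simp add: Sp4Z_simps G_def)
    show "block G 3 4 1 2 ** mat2 rho 0 0 \<i> + block G 3 4 3 4 = Q"
      by (simp add: block_simps G_def Q_def)
    show "block G 1 2 1 2 ** mat2 rho 0 0 \<i> + block G 1 2 3 4 = mat2 rho 0 0 \<i> ** Q"
      by (simp add: block_simps G_def Q_def) (use rho_cyclotomic in algebra)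
    \<comment> \<open>Squaring removes \<i>; as \<open>- rho\<close> is neither 0 nor 1, the
      determinant is neither 0 nor 1.\<close>
    have d2: "(det Q)\<^sup>2 = - rho"
      by (simp add: det power_mult_distrib rho2)
    then show "det Q \<noteq> 0" using rho_ne by auto
    have "det Q \<noteq> 1"
    proof
      assume "det Q = 1"
      with d2 have "- rho = 1" by simp
      then have "rho = - 1" by (metis minus_minus)
      with rho_ne show False by simp
    qed
    moreover have "(1 + det Q)\<^sup>2 - (trace Q)\<^sup>2 = 2 * (1 - (1 + rho)\<^sup>2)"
      unfolding det trace by (simp add: power2_eq_square algebra_simps)
    ultimately show "(1 - det Q) * ((1 + det Q)\<^sup>2 - (trace Q)\<^sup>2) \<noteq> 0"
      using rho_ne by (simp add: rho2)
  qed
qed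

end

theorem corollary4p3:
  fixes F :: "complex ^ 2 ^ 2 \<Rightarrow> complex"
  assumes differentiable: "F differentiable_on siegel_H2"
    and modular: "\<And>\<Gamma> M. \<Gamma> \<in> Sp4Z \<Longrightarrow> M \<in> siegel_H2 \<Longrightarrow> F (siegel_act \<Gamma> M) = F M"
  shows "\<forall>\<sigma> \<in> {sigma1, sigma2, sigma3, sigma4, sigma5, sigma6}. dM F \<sigma> = 0"
  using dM_sigma1[OF differentiable modular] dM_sigma2[OF differentiable modular]
    dM_sigma3[OF differentiable modular] dM_sigma4[OF differentiable modular]
    dM_sigma5[OF differentiable modular] dM_sigma6[OF differentiable modular]
  by simp

end
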